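(* Let $a<b$ be real numbers, $\alpha\in(0,1)$, and let $p,q,r$ be real-valued continuous functions on $[a,b]$ with $p(t)>0$ and $r(t)>0$ for all $t\in[a,b]$. Then every eigenvalue $\lambda\in\mathbb{C}$ of the fractional Sturm--Liouville equation $${}^{ABR}_{a}D^\alpha\big(p(t)\,{}^{ABR}D^\alpha_b x(t)\big)+q(t)x(t)=\lambda r(t)x(t),\qquad t\in(a,b),$$ is real.
   Context: For $\alpha\in(0,1)$, $E_\alpha(z)=\sum_{k=0}^\infty \frac{z^k}{\Gamma(\alpha k+1)}$ is the Mittag-Leffler function, and $B(\alpha)>0$ is a normalization constant. For a (complex-valued) $f\in H^1(a,b)$, identified with its continuous representative on $[a,b]$, the left and right ABR (Riemann--Liouville type) fractional derivatives with Mittag-Leffler kernel are $${}^{ABR}_{a}D^\alpha f(t)=\frac{B(\alpha)}{1-\alpha}\frac{d}{dt}\int_a^t f(x)E_\alpha\Big(\tfrac{-\alpha}{1-\alpha}(t-x)^\alpha\Big)dx,\qquad {}^{ABR}D^\alpha_b f(t)=-\frac{B(\alpha)}{1-\alpha}\frac{d}{dt}\int_t^b f(x)E_\alpha\Big(\tfrac{-\alpha}{1-\alpha}(x-t)^\alpha\Big)dx,$$ with one-sided derivatives at the endpoints of $[a,b]$. A solution of the equation is a complex-valued $x\in H^1(a,b)$ with $p\cdot{}^{ABR}D_b^\alpha x\in H^1(a,b)$ satisfying the equation. An eigenvalue is a $\lambda\in\mathbb{C}$ for which there is a nontrivial solution (one not identically zero), called an eigenfunction corresponding to $\lambda$. 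*)

theory Defs
  imports "HOL-Analysis.Analysis"
begin

definition L2_on :: "real set \<Rightarrow> (real \<Rightarrow> complex) \<Rightarrow> bool" where
  "L2_on S f \<longleftrightarrow>
     f \<in> borel_measurable (lebesgue_on S) \<and>
     integrable (lebesgue_on S) (\<lambda>t. (cmod (f t))\<^sup>2)"

text \<open>Test functions, \<open>C\<^sub>c\<^sup>\<infinity>(S)\<close> for open \<open>S\<close>, extended by zero to the whole line.\<close>

definition test_function_on :: "real set \<Rightarrow> (real \<Rightarrow> real) \<Rightarrow> bool" where
  "test_function_on S \<phi> \<longleftrightarrow>
     (\<forall>n t. (deriv ^^ n) \<phi> field_differentiable (at t)) \<and>
     compact (closure {t. \<phi> t \<noteq> 0}) \<and> closure {t. \<phi> t \<noteq> 0} \<subseteq> S"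

definition weak_derivative_on ::
  "real set \<Rightarrow> (real \<Rightarrow> complex) \<Rightarrow> (real \<Rightarrow> complex) \<Rightarrow> bool" where
  "weak_derivative_on S f g \<longleftrightarrow>
     (\<forall>\<phi>. test_function_on S \<phi> \<longrightarrow>
        (LINT t|lebesgue_on S. f t * of_real (deriv \<phi> t)) =
        - (LINT t|lebesgue_on S. g t * of_real (\<phi> t)))"

text \<open>
  Elements of \<open>H\<^sup>1(a,b)\<close> are identified with their continuous representatives on \<open>[a,b]\<close>,
  so continuity on the closed interval is part of the predicate. Only the values of \<open>f\<close>
  on \<open>[a,b]\<close> matter.
\<close>

definition H1 :: "real \<Rightarrow> real \<Rightarrow> (real \<Rightarrow> complex) \<Rightarrow> bool" where
  "H1 a b f \<longleftrightarrow>
     continuous_on {a..b} f \<and> L2_on {a<..<b} f \<and>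
     (\<exists>g. L2_on {a<..<b} g \<and> weak_derivative_on {a<..<b} f g)"

definition mittag_leffler :: "real \<Rightarrow> 'a::{real_normed_field,banach} \<Rightarrow> 'a" where
  "mittag_leffler \<alpha> z = (\<Sum>k. z ^ k / of_real (Gamma (\<alpha> * real k + 1)))"

text \<open>
  The derivatives are taken within \<open>[a,b]\<close>, hence are one-sided at the endpoints and
  two-sided in the interior. They exist at every point of \<open>[a,b]\<close> when
  \<open>0 < \<alpha> < 1\<close> and \<open>f\<close> is continuous on \<open>[a,b]\<close>.
\<close>

definition ABR_left ::
  "(real \<Rightarrow> real) \<Rightarrow> real \<Rightarrow> real \<Rightarrow> real \<Rightarrow> (real \<Rightarrow> complex) \<Rightarrow> real \<Rightarrow> complex" where
  "ABR_left B \<alpha> a b f t =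
     of_real (B \<alpha> / (1 - \<alpha>)) *
     vector_derivative
       (\<lambda>s. integral {a..s}
          (\<lambda>x. f x * of_real (mittag_leffler \<alpha> (- \<alpha> / (1 - \<alpha>) * (s - x) powr \<alpha>))))
       (at t within {a..b})"

definition ABR_right ::
  "(real \<Rightarrow> real) \<Rightarrow> real \<Rightarrow> real \<Rightarrow> real \<Rightarrow> (real \<Rightarrow> complex) \<Rightarrow> real \<Rightarrow> complex" where
  "ABR_right B \<alpha> a b f t =
     - of_real (B \<alpha> / (1 - \<alpha>)) *
     vector_derivative
       (\<lambda>s. integral {s..b}
          (\<lambda>x. f x * of_real (mittag_leffler \<alpha> (- \<alpha> / (1 - \<alpha>) * (x - s) powr \<alpha>))))
       (at t within {a..b})"

definition FSL_solution ::
  "(real \<Rightarrow> real) \<Rightarrow> real \<Rightarrow> real \<Rightarrow> real \<Rightarrow> (real \<Rightarrow> real) \<Rightarrow> (real \<Rightarrow> real) \<Rightarrow> (real \<Rightarrow> real) \<Rightarrow>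
   complex \<Rightarrow> (real \<Rightarrow> complex) \<Rightarrow> bool" where
  "FSL_solution B \<alpha> a b p q r \<mu> x \<longleftrightarrow>
     H1 a b x \<and>
     H1 a b (\<lambda>t. of_real (p t) * ABR_right B \<alpha> a b x t) \<and>
     (\<forall>t\<in>{a<..<b}.
        ABR_left B \<alpha> a b (\<lambda>s. of_real (p s) * ABR_right B \<alpha> a b x s) t + of_real (q t) * x t =
        \<mu> * of_real (r t) * x t)"

definition FSL_eigenvalue ::
  "(real \<Rightarrow> real) \<Rightarrow> real \<Rightarrow> real \<Rightarrow> real \<Rightarrow> (real \<Rightarrow> real) \<Rightarrow> (real \<Rightarrow> real) \<Rightarrow> (real \<Rightarrow> real) \<Rightarrow>
   complex \<Rightarrow> bool" where
  "FSL_eigenvalue B \<alpha> a b p q r \<mu> \<longleftrightarrow>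
     (\<exists>x. FSL_solution B \<alpha> a b p q r \<mu> x \<and> (\<exists>t\<in>{a..b}. x t \<noteq> 0))"

end

theory Submission
  imports Defs
begin

text \<open>
  Write \<open>E\<^sub>\<alpha>(c u\<^sup>\<alpha>) = 1 + \<integral>\<^sub>0\<^sup>u k\<close>. The density \<open>k\<close> is \<open>O(u\<^sup>\<alpha>\<^sup>-\<^sup>1)\<close> at \<open>0\<close>, hence
  integrable, so for continuous \<open>f\<close> the left and right derivatives are
  \<open>\<beta> (f + \<integral> f(x) k(t - x) dx)\<close> and \<open>\<beta> (f + \<integral> f(x) k(x - t) dx)\<close>, with \<open>k\<close> vanishing on the
  negative axis. By Fubini the two operators are formally adjoint. Pairing the equation with the
  conjugate of an eigenfunction \<open>x\<close> therefore gives
  \<open>\<mu> \<integral> r |x|\<^sup>2 = \<integral> p |D x|\<^sup>2 + \<integral> q |x|\<^sup>2\<close>, where \<open>D\<close> is the right derivative.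
\<close>

section \<open>The Mittag-Leffler series and the density of its kernel\<close>

text \<open>Euler's integral is cut down to \<open>{R..}\<close>, where \<open>t powr x\<close> is
  at least \<open>R powr x\<close>. Since \<open>R\<close> is free, Gamma is seen to outgrow every
  exponential.\<close>

lemma Gamma_lower_bound:
  fixes x R :: real
  assumes "x \<ge> 0" "R > 0"
  shows "R powr x * exp (- R) \<le> Gamma (x + 1)"
proof -
  have "((\<lambda>t. exp (-1 * t)) has_integral exp (-1 * R) / 1) {R..}"
    by (rule has_integral_exp_minus_to_infinity) simp
  hence "((\<lambda>t. R powr x * exp (- t)) has_integral R powr x * exp (- R)) {R..}"
    by (intro has_integral_mult_right) simp
  hence "((\<lambda>t. if t \<in> {R..} then R powr x * exp (- t) else 0) has_integral
            R powr x * exp (- R)) {0..}"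
    using assms by (subst has_integral_restrict) auto
  moreover have "((\<lambda>t. t powr (x + 1 - 1) / exp t) has_integral Gamma (x + 1)) {0..}"
    using assms by (intro Gamma_integral_real) auto
  ultimately show ?thesis
    by (rule has_integral_le)
      (use assms in \<open>auto simp: exp_minus field_simps intro!: powr_mono2\<close>)
qed

lemma mittag_leffler_summable:
  fixes \<alpha> z :: real
  assumes "\<alpha> > 0"
  shows "summable (\<lambda>k. inverse (Gamma (\<alpha> * real k + 1)) * z ^ k)"
proof -
  \<comment> \<open>This \<open>R\<close> turns the Gamma bound at \<alpha> k into a multiple of the
    k-th power of \<open>2 * \<bar>z\<bar> + 1\<close>, so the terms are dominated by a geometric
    series of ratio \<open>y < 1\<close>. Adding 1 covers \<open>z = 0\<close>.\<close>
  define R where "R = (2 * \<bar>z\<bar> + 1) powr (1 / \<alpha>)"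
  have R: "R > 0" "R powr \<alpha> = 2 * \<bar>z\<bar> + 1"
    using assms by (auto simp: R_def powr_powr)
  define y where "y = \<bar>z\<bar> / (2 * \<bar>z\<bar> + 1)"
  have y: "0 \<le> y" "y < 1" by (auto simp: y_def field_simps)
  have "norm (inverse (Gamma (\<alpha> * real k + 1)) * z ^ k) \<le> exp R * y ^ k" for k
  proof -
    have "(2 * \<bar>z\<bar> + 1) ^ k * exp (- R) = R powr (\<alpha> * k) * exp (- R)"
      using R by (simp add: powr_powr [symmetric] powr_realpow)
    also have "\<dots> \<le> Gamma (\<alpha> * k + 1)"
      using assms R by (intro Gamma_lower_bound) auto
    finally have *: "(2 * \<bar>z\<bar> + 1) ^ k * exp (- R) \<le> Gamma (\<alpha> * k + 1)" .
    have pos: "0 < (2 * \<bar>z\<bar> + 1) ^ k * exp (- R)" by (auto intro!: mult_pos_pos zero_less_power)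
    have "norm (inverse (Gamma (\<alpha> * real k + 1)) * z ^ k)
        = inverse (Gamma (\<alpha> * real k + 1)) * \<bar>z\<bar> ^ k"
      using order_less_le_trans[OF pos *] by (simp add: abs_mult power_abs)
    also have "\<dots> \<le> inverse ((2 * \<bar>z\<bar> + 1) ^ k * exp (- R)) * \<bar>z\<bar> ^ k"
      using * pos by (intro mult_right_mono le_imp_inverse_le) auto
    also have "\<dots> = exp R * y ^ k"
      by (simp add: y_def exp_minus power_divide field_simps)
    finally show ?thesis .
  qed
  moreover have "summable (\<lambda>k. exp R * y ^ k)"
    using y by (intro summable_mult summable_geometric) auto
  ultimately show ?thesis by (rule summable_comparison_test'[of _ 0, rotated])
qed

lemma mittag_leffler_0 [simp]: "mittag_leffler \<alpha> (0 :: real) = 1"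
  unfolding mittag_leffler_def
  by (subst suminf_finite[of "{0}"]) auto

text \<open>The power series converges everywhere, so it can be differentiated term by term; the
  derived series converges everywhere too and is therefore continuous.\<close>

lemma mittag_leffler_derivative:
  fixes \<alpha> :: real
  assumes "\<alpha> > 0"
  obtains E' :: "real \<Rightarrow> real"
  where "\<And>z. (mittag_leffler \<alpha> has_field_derivative E' z) (at z)" "continuous_on UNIV E'"
proof
  let ?c = "\<lambda>k. inverse (Gamma (\<alpha> * real k + 1))"
  have *: "mittag_leffler \<alpha> = (\<lambda>z. \<Sum>k. ?c k * z ^ k)"
    by (simp add: mittag_leffler_def fun_eq_iff divide_inverse mult.commute)
  note s = mittag_leffler_summable[OF assms]
  show "(mittag_leffler \<alpha> has_field_derivative (\<Sum>k. diffs ?c k * z ^ k)) (at z)" for z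
    unfolding * by (rule termdiffs_strong_converges_everywhere[OF s])
  have "summable (\<lambda>k. diffs ?c k * z ^ k)" for z
    by (rule termdiff_converges_all[OF s])
  thus "continuous_on UNIV (\<lambda>z. \<Sum>k. diffs ?c k * z ^ k)"
    by (intro continuous_at_imp_continuous_on ballI isCont_powser_converges_everywhere)
qed

text \<open>The chain rule gives the density. It may be singular at 0, but the factor from the
  Mittag-Leffler derivative is bounded on \<open>{0..L}\<close> and
  \<open>u powr (\<alpha> - 1)\<close> is integrable there. Cutting off outside
  \<open>{0<..<L}\<close> gives an integrable function on the whole line, ready for convolution,
  that vanishes for \<open>u \<le> 0\<close>.\<close>

lemma mittag_leffler_kernel:
  fixes \<alpha> c L :: real
  assumes "0 < \<alpha>" "L > 0"
  obtains k :: "real \<Rightarrow> real"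
  where "integrable lborel k" "\<And>u. u \<le> 0 \<Longrightarrow> k u = 0"
    "\<And>u. u \<in> {0..L} \<Longrightarrow>
      (k has_integral mittag_leffler \<alpha> (c * u powr \<alpha>) - 1) {0..u}"
proof -
  obtain E' :: "real \<Rightarrow> real" where E': "\<And>z. (mittag_leffler \<alpha> has_field_derivative E' z) (at z)"
      "continuous_on UNIV E'"
    using mittag_leffler_derivative[OF assms(1)] by blast
  define k where "k = (\<lambda>u. indicator {0<..<L} u *\<^sub>R (E' (c * u powr \<alpha>) * (c * (\<alpha> * u powr (\<alpha> - 1)))))"
  have cpowr: "continuous_on {0..v} (\<lambda>u. c * u powr \<alpha>)" for v
    using assms by (intro continuous_on_mult continuous_on_const continuous_on_powr' continuous_on_id) auto
  have cE: "continuous_on {0..L} (\<lambda>u. E' (c * u powr \<alpha>))"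
    by (rule continuous_on_compose2[OF E'(2) cpowr]) simp
  hence "bounded ((\<lambda>u. E' (c * u powr \<alpha>)) ` {0..L})"
    by (intro compact_imp_bounded compact_continuous_image) auto
  then obtain M where M: "\<And>u. u \<in> {0..L} \<Longrightarrow> \<bar>E' (c * u powr \<alpha>)\<bar> \<le> M"
    unfolding bounded_iff by (metis image_eqI real_norm_def)
  have meas: "k \<in> borel_measurable borel"
    unfolding k_def
    by (intro borel_measurable_continuous_on_indicator continuous_intros continuous_on_subset[OF cE])
      auto
  have "k absolutely_integrable_on {0..L}"
  proof (rule measurable_bounded_by_integrable_imp_absolutely_integrable)
    show "k \<in> borel_measurable (lebesgue_on {0..L})"
      using meas by (simp add: borel_measurable_if_D measurable_completion measurable_restrict_space1)
    show "(\<lambda>u. (M * \<bar>c * \<alpha>\<bar>) * u powr (\<alpha> - 1)) integrable_on {0..L}"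
      using assms by (intro integrable_on_mult_right integrable_on_powr_from_0) auto
    show "norm (k u) \<le> (M * \<bar>c * \<alpha>\<bar>) * u powr (\<alpha> - 1)" if "u \<in> {0..L}" for u
    proof -
      have "0 \<le> M" using M[OF that] by linarith
      thus ?thesis
        using M[OF that] that assms
        by (auto simp: k_def indicator_def abs_mult mult.assoc
            intro!: mult_right_mono)
    qed
  qed auto
  hence "integrable lebesgue (\<lambda>u. indicator {0..L} u *\<^sub>R k u)"
    by (simp add: set_integrable_def)
  moreover have "(\<lambda>u. indicator {0..L} u *\<^sub>R k u) = k"
    by (auto simp: k_def indicator_def)
  ultimately have int: "integrable lborel k"
    using meas by (simp add: integrable_completion)
  have "(k has_integral mittag_leffler \<alpha> (c * u powr \<alpha>) - 1) {0..u}" if u: "u \<in> {0..L}" for u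
  proof -
    have "(k has_integral
      mittag_leffler \<alpha> (c * u powr \<alpha>) - mittag_leffler \<alpha> (c * 0 powr \<alpha>)) {0..u}"
    \<comment> \<open>The antiderivative need only be continuous at the endpoints, so a singularity
      of \<open>k\<close> at 0 does no harm.\<close>
    proof (rule fundamental_theorem_of_calculus_interior)
      have "continuous_on UNIV (mittag_leffler \<alpha> :: real \<Rightarrow> real)"
        by (rule DERIV_continuous_on) (use E' in auto)
      thus "continuous_on {0..u} (\<lambda>u. mittag_leffler \<alpha> (c * u powr \<alpha>))"
        by (rule continuous_on_compose2[OF _ cpowr]) simp
      fix v assume v: "v \<in> {0<..<u}"
      have "((\<lambda>u. mittag_leffler \<alpha> (c * u powr \<alpha>)) has_real_derivative
          E' (c * v powr \<alpha>) * (c * (\<alpha> * v powr (\<alpha> - 1)))) (at v)"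
        by (rule DERIV_chain2[OF E'(1)])
          (use v in \<open>auto intro!: derivative_eq_intros simp: powr_diff\<close>)
      thus "((\<lambda>u. mittag_leffler \<alpha> (c * u powr \<alpha>)) has_vector_derivative k v) (at v)"
        using u v by (simp add: k_def has_real_derivative_iff_has_vector_derivative)
    qed (use u in auto)
    thus ?thesis using assms by simp
  qed
  moreover have "k u = 0" if "u \<le> 0" for u using that by (simp add: k_def)
  ultimately show ?thesis using that int by blast
qed

section \<open>Convolutions on the line and extension by zero\<close>

text \<open>Fubini for an integrable double integrand times a bounded factor. It serves twice: with
  \<open>g\<close> an indicator it computes the primitive of a convolution, and with
  \<open>g\<close> a conjugated function it gives the adjointness of the two fractional
  derivatives.\<close>

lemma convolution_adjoint:
  fixes f g \<kappa> :: "real \<Rightarrow> complex"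
  assumes "integrable lborel f" "integrable lborel \<kappa>"
    and "g \<in> borel_measurable borel" "\<And>x. norm (g x) \<le> C"
  shows "(LBINT y. g y * (LBINT x. f x * \<kappa> (y - x))) = (LBINT x. f x * (LBINT y. g y * \<kappa> (y - x)))"
proof -
  note [measurable] = assms(3) borel_measurable_integrable[OF assms(1)]
    borel_measurable_integrable[OF assms(2)]
  \<comment> \<open>By translation invariance the inner integral of the norm does not depend on
    \<open>x\<close>, so the iterated integral is the product of two finite L1 norms.\<close>
  have shift: "integrable lborel (\<lambda>y. \<kappa> (y - x))"
      "(LBINT y. norm (\<kappa> (y - x))) = (LBINT y. norm (\<kappa> y))" for x
    using lborel_integrable_real_affine[OF assms(2), of 1 "-x"]
      lborel_integral_real_affine[of 1 "\<lambda>y. norm (\<kappa> y)" "-x"] by simp_all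
  have "integrable (lborel \<Otimes>\<^sub>M lborel) (\<lambda>(x, y). f x * \<kappa> (y - x))"
  proof (rule lborel_pair.Fubini_integrable)
    show "integrable lborel (\<lambda>x. LBINT y. norm (case (x, y) of (x, y) \<Rightarrow> f x * \<kappa> (y - x)))"
      using assms(1) by (simp add: norm_mult shift)
    show "AE x in lborel. integrable lborel (\<lambda>y. case (x, y) of (x, y) \<Rightarrow> f x * \<kappa> (y - x))"
      by (simp add: shift)
  qed measurable
  hence "integrable (lborel \<Otimes>\<^sub>M lborel) (\<lambda>p. of_real C * (case p of (x, y) \<Rightarrow> f x * \<kappa> (y - x)))"
    by (rule integrable_mult_right)
  hence "integrable (lborel \<Otimes>\<^sub>M lborel) (\<lambda>(x, y). g y * (f x * \<kappa> (y - x)))"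
  proof (rule Bochner_Integration.integrable_bound)
    have "norm (g y) \<le> \<bar>C\<bar>" for y using assms(4)[of y] by linarith
    thus "AE p in lborel \<Otimes>\<^sub>M lborel. norm (case p of (x, y) \<Rightarrow> g y * (f x * \<kappa> (y - x)))
       \<le> norm (of_real C * (case p of (x, y) \<Rightarrow> f x * \<kappa> (y - x)))"
      by (intro always_eventually allI) (auto simp: norm_mult simp del: mult_cancel_left intro!: mult_right_mono)
  qed measurable
  from lborel_pair.Fubini_integral[OF this]
  have "(LBINT y. LBINT x. g y * (f x * \<kappa> (y - x))) = (LBINT x. LBINT y. g y * (f x * \<kappa> (y - x)))" .
  also have "\<dots> = (LBINT x. LBINT y. f x * (g y * \<kappa> (y - x)))"
    by (simp add: mult_ac)
  finally show ?thesis by simp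
qed

text \<open>A substitution moves the translation from \<kappa> onto \<open>f\<close>; then dominated
  convergence applies with majorant \<open>C * norm (\<kappa> u)\<close>. The finite set
  \<open>N\<close> allows for the jumps of a zero extension at the ends of the interval.\<close>

lemma convolution_continuous:
  fixes f \<kappa> :: "real \<Rightarrow> complex"
  assumes "integrable lborel \<kappa>"
    and "f \<in> borel_measurable borel" "\<And>x. norm (f x) \<le> C"
    and "finite N" "\<And>x. x \<notin> N \<Longrightarrow> isCont f x"
  shows "continuous_on UNIV (\<lambda>y. LBINT x. f x * \<kappa> (y - x))"
proof -
  note [measurable] = assms(2) borel_measurable_integrable[OF assms(1)]
  have eq: "(LBINT x. f x * \<kappa> (y - x)) = (LBINT u. f (y - u) * \<kappa> u)" for y
    using lborel_integral_real_affine[of "-1" "\<lambda>x. f x * \<kappa> (y - x)" y] by simp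
  show ?thesis
    unfolding continuous_on_sequentially eq o_def
  proof (intro allI ballI impI)
    fix s y assume "(\<forall>n. s n \<in> (UNIV :: real set)) \<and> s \<longlonglongrightarrow> y"
    hence s: "s \<longlonglongrightarrow> y" by simp
    show "(\<lambda>n. LBINT u. f (s n - u) * \<kappa> u) \<longlonglongrightarrow> (LBINT u. f (y - u) * \<kappa> u)"
    proof (rule integral_dominated_convergence)
      show "integrable lborel (\<lambda>u. C * norm (\<kappa> u))" using assms(1) by simp
      have "AE u in lborel. u \<notin> (\<lambda>x. y - x) ` N"
        by (rule AE_not_in) (use assms(4) in \<open>auto intro!: finite_imp_null_set_lborel\<close>)
      thus "AE u in lborel. (\<lambda>n. f (s n - u) * \<kappa> u) \<longlonglongrightarrow> f (y - u) * \<kappa> u"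
      proof (eventually_elim)
        case (elim u)
        hence "y - u \<notin> N" by (auto simp: image_iff)
        hence "isCont f (y - u)" by (rule assms(5))
        hence "(\<lambda>n. f (s n - u)) \<longlonglongrightarrow> f (y - u)"
          by (rule isCont_tendsto_compose) (intro tendsto_intros s)
        thus ?case by (intro tendsto_intros)
      qed
      show "AE u in lborel. norm (f (s n - u) * \<kappa> u) \<le> C * norm (\<kappa> u)" for n
        using assms(3) by (auto simp: norm_mult intro!: mult_right_mono)
    qed measurable
  qed
qed

text \<open>Integrals over an interval with moving limits become convolutions on the line, to which
  Fubini and translation invariance apply directly.\<close>

definition zero_ext :: "real \<Rightarrow> real \<Rightarrow> (real \<Rightarrow> complex) \<Rightarrow> real \<Rightarrow> complex" where
  "zero_ext a b f x = indicator {a..b} x *\<^sub>R f x"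

lemma zero_ext_eq [simp]: "x \<in> {a..b} \<Longrightarrow> zero_ext a b f x = f x"
  by (simp add: zero_ext_def)

context
  fixes a b :: real and f :: "real \<Rightarrow> complex"
  assumes cont: "continuous_on {a..b} f"
begin

lemma zero_ext_integrable: "integrable lborel (zero_ext a b f)"
  using borel_integrable_compact[OF compact_Icc cont] by (simp add: zero_ext_def [abs_def])

lemma zero_ext_measurable: "zero_ext a b f \<in> borel_measurable borel"
  using borel_measurable_continuous_on_indicator[OF _ cont] by (simp add: zero_ext_def [abs_def])

lemma integral_zero_ext: "(LBINT x. zero_ext a b f x) = integral {a..b} f"
  using set_borel_integral_eq_integral(2)[OF borel_integrable_atLeastAtMost'[OF cont]]
  by (simp add: zero_ext_def [abs_def] set_lebesgue_integral_def)

lemma zero_ext_bounded: obtains C where "\<And>x. norm (zero_ext a b f x) \<le> C"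
proof -
  have "bounded (f ` {a..b})"
    by (intro compact_imp_bounded compact_continuous_image cont) auto
  then obtain C where "\<And>x. x \<in> {a..b} \<Longrightarrow> norm (f x) \<le> C"
    unfolding bounded_iff by (metis image_eqI)
  hence "norm (zero_ext a b f x) \<le> max 0 C" for x
    by (force simp: zero_ext_def indicator_def le_max_iff_disj)
  thus ?thesis by (rule that)
qed

lemma zero_ext_isCont:
  assumes "x \<notin> {a, b}"
  shows "isCont (zero_ext a b f) x"
proof (cases "x \<in> {a..b}")
  case True
  hence x: "x \<in> {a<..<b}" using assms by auto
  have "continuous_on {a<..<b} (zero_ext a b f)"
    using continuous_on_subset[OF cont, of "{a<..<b}"]
    by (rule continuous_on_cong[THEN iffD1, rotated -1]) auto
  thus ?thesis using x by (simp add: continuous_on_eq_continuous_at)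
next
  case False
  have "continuous_on (- {a..b}) (\<lambda>_. 0 :: complex)" by simp
  hence "continuous_on (- {a..b}) (zero_ext a b f)"
    by (rule continuous_on_cong[THEN iffD1, rotated -1]) (auto simp: zero_ext_def)
  thus ?thesis using False by (simp add: continuous_on_eq_continuous_at open_Compl)
qed

lemma zero_ext_convolution_continuous:
  assumes "integrable lborel \<kappa>"
  shows "continuous_on S (\<lambda>y. LBINT x. zero_ext a b f x * \<kappa> (y - x))"
proof -
  obtain C where "\<And>x. norm (zero_ext a b f x) \<le> C"
    using zero_ext_bounded by blast
  from convolution_continuous[OF assms zero_ext_measurable this, of "{a, b}"]
  show ?thesis using zero_ext_isCont by (auto intro: continuous_on_subset)
qed

end

section \<open>Derivatives of the memory integrals\<close>

text \<open>Differentiating the singular kernel under the integral is avoided. With \<open>K\<close>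
  written as 1 plus the primitive of \<kappa>, Fubini turns the memory integral into the primitive
  of \<open>f\<close> plus its convolution with \<kappa>. That sum is continuous, so the fundamental
  theorem of calculus applies, one-sidedly at the endpoints.\<close>

lemma has_vector_derivative_memory_left:
  fixes f K \<kappa> :: "real \<Rightarrow> complex"
  assumes f: "continuous_on {a..b} f" and \<kappa>: "integrable lborel \<kappa>" "\<And>u. u \<le> 0 \<Longrightarrow> \<kappa> u = 0"
    and K: "continuous_on {0..b - a} K" "\<And>u. u \<in> {0..b - a} \<Longrightarrow> (\<kappa> has_integral K u - 1) {0..u}"
    and t: "t \<in> {a..b}"
  shows "((\<lambda>s. integral {a..s} (\<lambda>x. f x * K (s - x))) has_vector_derivative
           f t + (LBINT x. zero_ext a b f x * \<kappa> (t - x))) (at t within {a..b})"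
proof -
  define C where "C = (\<lambda>y. LBINT x. zero_ext a b f x * \<kappa> (y - x))"
  have C: "continuous_on S C" for S
    unfolding C_def by (rule zero_ext_convolution_continuous[OF f \<kappa>(1)])
  have eq: "integral {a..s} (\<lambda>x. f x * K (s - x)) = integral {a..s} (\<lambda>y. f y + C y)"
    if s: "s \<in> {a..b}" for s
  proof -
    have fs: "continuous_on {a..s} f" using s by (auto intro: continuous_on_subset[OF f])
    have Ks: "continuous_on {a..s} (\<lambda>x. K (s - x))"
      by (rule continuous_on_compose2[OF K(1)]) (use s in \<open>auto intro!: continuous_intros\<close>)
    \<comment> \<open>The values \<open>y < x\<close> contribute nothing because \<kappa> vanishes
      on the negative axis; what remains is the primitive of \<kappa> up to
      \<open>s - x\<close>.\<close>
    have inner: "(LBINT y. indicator {a..s} y * \<kappa> (y - x)) = K (s - x) - 1" if x: "x \<in> {a..s}" for x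
    proof -
      have "(LBINT y. indicator {a..s} y * \<kappa> (y - x)) = (LBINT u. indicator {a..s} (x + u) * \<kappa> u)"
        using lborel_integral_real_affine[of 1 "\<lambda>y. indicator {a..s} y * \<kappa> (y - x)" x] by simp
      also have "(\<lambda>u. indicator {a..s} (x + u) * \<kappa> u) = (\<lambda>u. indicator {0..s - x} u *\<^sub>R \<kappa> u)"
        using x \<kappa>(2) by (auto simp: indicator_def fun_eq_iff)
      also have "(LBINT u. indicator {0..s - x} u *\<^sub>R \<kappa> u) = integral {0..s - x} \<kappa>"
      proof -
        have "set_integrable lborel {0..s - x} \<kappa>"
          unfolding set_integrable_def using integrable_mult_indicator[OF _ \<kappa>(1)] by simp
        thus ?thesis
          using set_borel_integral_eq_integral(2) unfolding set_lebesgue_integral_def by blast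
      qed
      also have "\<dots> = K (s - x) - 1"
        using s x by (intro integral_unique K(2)) auto
      finally show ?thesis .
    qed
    have "integral {a..s} C = (LBINT y. indicator {a..s} y * C y)"
      using integral_zero_ext[OF C, of a s]
      by (simp add: zero_ext_def [abs_def] scaleR_conv_of_real of_real_indicator)
    also have "\<dots> = (LBINT x. zero_ext a b f x * (LBINT y. indicator {a..s} y * \<kappa> (y - x)))"
      unfolding C_def
      by (rule convolution_adjoint[OF zero_ext_integrable[OF f] \<kappa>(1), of _ 1])
        (auto simp: indicator_def)
    also have "(\<lambda>x. zero_ext a b f x * (LBINT y. indicator {a..s} y * \<kappa> (y - x)))
        = zero_ext a s (\<lambda>x. f x * (K (s - x) - 1))"
    proof
      fix x
      \<comment> \<open>For \<open>x > s\<close> every \<open>y \<le> s\<close> gives a negative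
        argument of \<kappa>, so the extension from \<open>{a..b}\<close> may be replaced by one
        from \<open>{a..s}\<close>.\<close>
      have "(\<lambda>y. indicator {a..s} y * \<kappa> (y - x)) = (\<lambda>y. 0)" if "x > s"
        using that \<kappa>(2) by (auto simp: indicator_def fun_eq_iff)
      thus "zero_ext a b f x * (LBINT y. indicator {a..s} y * \<kappa> (y - x))
          = zero_ext a s (\<lambda>x. f x * (K (s - x) - 1)) x"
        using s inner[of x] by (cases "x \<in> {a..s}") (auto simp: zero_ext_def)
    qed
    also have "(LBINT x. zero_ext a s (\<lambda>x. f x * (K (s - x) - 1)) x)
        = integral {a..s} (\<lambda>x. f x * (K (s - x) - 1))"
      by (intro integral_zero_ext continuous_intros fs Ks)
    finally have C_eq: "integral {a..s} C = integral {a..s} (\<lambda>x. f x * (K (s - x) - 1))" .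
    have "integral {a..s} (\<lambda>y. f y + C y) = integral {a..s} f + integral {a..s} C"
      by (intro Henstock_Kurzweil_Integration.integral_add integrable_continuous_real fs C)
    also have "\<dots> = integral {a..s} (\<lambda>x. f x + f x * (K (s - x) - 1))"
      unfolding C_eq
      by (intro Henstock_Kurzweil_Integration.integral_add [symmetric]
          integrable_continuous_real continuous_intros fs Ks)
    finally show ?thesis by (simp add: algebra_simps)
  qed
  have "((\<lambda>s. integral {a..s} (\<lambda>y. f y + C y)) has_vector_derivative f t + C t) (at t within {a..b})"
    by (intro integral_has_vector_derivative continuous_intros f C t)
  thus ?thesis
    using has_vector_derivative_transform[OF t eq] by (simp add: C_def)
qed

text \<open>The reflection of \<open>{a..b}\<close> about its midpoint reduces this to the left
  case; the chain rule supplies the minus sign.\<close>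

lemma has_vector_derivative_memory_right:
  fixes f K \<kappa> :: "real \<Rightarrow> complex"
  assumes f: "continuous_on {a..b} f" and \<kappa>: "integrable lborel \<kappa>" "\<And>u. u \<le> 0 \<Longrightarrow> \<kappa> u = 0"
    and K: "continuous_on {0..b - a} K" "\<And>u. u \<in> {0..b - a} \<Longrightarrow> (\<kappa> has_integral K u - 1) {0..u}"
    and t: "t \<in> {a..b}"
  shows "((\<lambda>s. integral {s..b} (\<lambda>x. f x * K (x - s))) has_vector_derivative
           - (f t + (LBINT x. zero_ext a b f x * \<kappa> (x - t)))) (at t within {a..b})"
proof -
  let ?g = "\<lambda>x. f (a + b - x)" and ?\<sigma> = "\<lambda>s. a + b - s"
  have g: "continuous_on {a..b} ?g"
    by (rule continuous_on_compose2[OF f]) (auto intro!: continuous_intros)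
  have im: "?\<sigma> ` {a..b} = {a..b}" by (auto intro!: image_eqI[of _ _ "a + b - _"])
  have "((\<lambda>s. integral {a..s} (\<lambda>x. ?g x * K (s - x))) has_vector_derivative
      ?g (?\<sigma> t) + (LBINT x. zero_ext a b ?g x * \<kappa> (?\<sigma> t - x))) (at (?\<sigma> t) within {a..b})"
    by (rule has_vector_derivative_memory_left[OF g \<kappa> K]) (use t in auto)
  moreover have "(LBINT x. zero_ext a b ?g x * \<kappa> (?\<sigma> t - x)) = (LBINT x. zero_ext a b f x * \<kappa> (x - t))"
  proof -
    have "zero_ext a b f (a + b - x) = zero_ext a b ?g x" for x
      by (auto simp: zero_ext_def indicator_def)
    thus ?thesis
      using lborel_integral_real_affine[of "-1" "\<lambda>x. zero_ext a b f x * \<kappa> (x - t)" "a + b"]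
      by (simp add: algebra_simps)
  qed
  ultimately have "((\<lambda>s. integral {a..s} (\<lambda>x. ?g x * K (s - x))) has_vector_derivative
      f t + (LBINT x. zero_ext a b f x * \<kappa> (x - t))) (at (?\<sigma> t) within ?\<sigma> ` {a..b})"
    unfolding im by simp
  moreover have "(?\<sigma> has_vector_derivative - 1) (at t within {a..b})"
    by (auto intro!: derivative_eq_intros)
  ultimately have "((\<lambda>s. integral {a..?\<sigma> s} (\<lambda>x. ?g x * K (?\<sigma> s - x))) has_vector_derivative
      - (f t + (LBINT x. zero_ext a b f x * \<kappa> (x - t)))) (at t within {a..b})"
    using vector_diff_chain_within by (fastforce simp: o_def)
  \<comment> \<open>The reflection is split into a shift by \<open>a + b\<close> and a sign
    change.\<close>
  moreover have "integral {a..?\<sigma> s} (\<lambda>x. ?g x * K (?\<sigma> s - x)) = integral {s..b} (\<lambda>x. f x * K (x - s))" for s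
    using integral_shift_real_ivl[of s "a + b" b "\<lambda>x. f x * K (x - s)"]
      Henstock_Kurzweil_Integration.integral_reflect_real
        [of "-a" "s - (a + b)" "\<lambda>x. f (x + (a + b)) * K (x + (a + b) - s)"]
    by (simp add: algebra_simps)
  ultimately show ?thesis by simp
qed

section \<open>Reality of the eigenvalues\<close>

theorem theorem6:
  fixes a b \<alpha> :: real and B p q r :: "real \<Rightarrow> real" and \<mu> :: complex
  assumes "a < b" and "0 < \<alpha>" and "\<alpha> < 1" and "B \<alpha> > 0"
    and "continuous_on {a..b} p" and "continuous_on {a..b} q" and "continuous_on {a..b} r"
    and "\<forall>t\<in>{a..b}. p t > 0" and "\<forall>t\<in>{a..b}. r t > 0"
    and "FSL_eigenvalue B \<alpha> a b p q r \<mu>"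
  shows "\<mu> \<in> \<real>"
proof -
  let ?c = "- \<alpha> / (1 - \<alpha>)"
  \<comment> \<open>The cut-off is at \<open>b - a\<close>, the largest distance between two points
    of the interval.\<close>
  obtain k :: "real \<Rightarrow> real" where k: "integrable lborel k" "\<And>u. u \<le> 0 \<Longrightarrow> k u = 0"
    "\<And>u. u \<in> {0..b - a} \<Longrightarrow>
      (k has_integral mittag_leffler \<alpha> (?c * u powr \<alpha>) - 1) {0..u}"
    by (rule mittag_leffler_kernel[of \<alpha> "b - a" ?c]) (use assms in auto)
  define K where "K = (\<lambda>u. complex_of_real (mittag_leffler \<alpha> (?c * u powr \<alpha>)))"
  define \<kappa> where "\<kappa> = (\<lambda>u. complex_of_real (k u))"
  have \<kappa>: "integrable lborel \<kappa>" "\<And>u. u \<le> 0 \<Longrightarrow> \<kappa> u = 0"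
    using k by (simp_all add: \<kappa>_def)
  have \<kappa>_int: "(\<kappa> has_integral K u - 1) {0..u}" if "u \<in> {0..b - a}" for u
    using has_integral_of_real[OF k(3)[OF that], where 'b = complex] by (simp add: \<kappa>_def K_def)
  \<comment> \<open>Continuity comes from the representation as 1 plus an indefinite
    integral.\<close>
  have K: "continuous_on {0..b - a} K"
  proof -
    have "continuous_on {0..b - a} (\<lambda>u. 1 + integral {0..u} \<kappa>)"
      using \<kappa>_int[of "b - a"] assms(1)
      by (intro continuous_intros indefinite_integral_continuous_1) auto
    moreover have "1 + integral {0..u} \<kappa> = K u" if "u \<in> {0..b - a}" for u
      using integral_unique[OF \<kappa>_int[OF that]] by simp
    ultimately show ?thesis
      by (rule continuous_on_eq)
  qed
  define \<beta> where "\<beta> = B \<alpha> / (1 - \<alpha>)"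
  define L where "L = (\<lambda>f t. LBINT x. zero_ext a b f x * \<kappa> (t - x))"
  define R where "R = (\<lambda>f t. LBINT x. zero_ext a b f x * \<kappa> (x - t))"
  \<comment> \<open>Derivatives within \<open>{a..b}\<close> are unique because
    \<open>a < b\<close>, so the formula holds at the endpoints as well.\<close>
  have ABR_left: "ABR_left B \<alpha> a b f t = of_real \<beta> * (f t + L f t)"
    if "continuous_on {a..b} f" "t \<in> {a..b}" for f t
    unfolding ABR_left_def L_def \<beta>_def
    by (subst vector_derivative_within_cbox[OF assms(1), unfolded box_real, OF that(2)
          has_vector_derivative_memory_left[OF that(1) \<kappa> K \<kappa>_int that(2), unfolded K_def]])
      simp_all
  have ABR_right: "ABR_right B \<alpha> a b f t = of_real \<beta> * (f t + R f t)"
    if "continuous_on {a..b} f" "t \<in> {a..b}" for f t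
    unfolding ABR_right_def R_def \<beta>_def
    by (subst vector_derivative_within_cbox[OF assms(1), unfolded box_real, OF that(2)
          has_vector_derivative_memory_right[OF that(1) \<kappa> K \<kappa>_int that(2), unfolded K_def]])
      (simp_all only: minus_mult_minus)
  have L_cont: "continuous_on {a..b} (L f)" if "continuous_on {a..b} f" for f
    unfolding L_def by (rule zero_ext_convolution_continuous[OF that \<kappa>(1)])
  have R_cont: "continuous_on {a..b} (R f)" if "continuous_on {a..b} f" for f
  proof -
    \<comment> \<open>\<open>R\<close> is convolution with the reflected density, to which the
      continuity result for convolutions applies.\<close>
    have "integrable lborel (\<lambda>u. \<kappa> (- u))"
      using lborel_integrable_real_affine[OF \<kappa>(1), of "-1" 0] by simp
    from zero_ext_convolution_continuous[OF that this, of "{a..b}"]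
    show ?thesis by (simp add: R_def)
  qed

  obtain x where x: "FSL_solution B \<alpha> a b p q r \<mu> x" and nz: "\<exists>t\<in>{a..b}. x t \<noteq> 0"
    using assms(10) by (auto simp: FSL_eigenvalue_def)
  define y where "y = (\<lambda>t. of_real (p t) * ABR_right B \<alpha> a b x t)"
  have xc: "continuous_on {a..b} x" and yc: "continuous_on {a..b} y"
    and eq: "\<And>t. t \<in> {a<..<b} \<Longrightarrow>
      ABR_left B \<alpha> a b y t + of_real (q t) * x t = \<mu> * of_real (r t) * x t"
    using x by (auto simp: FSL_solution_def H1_def y_def)
  note cont = continuous_intros xc yc L_cont[OF yc] R_cont[OF xc] assms(5,6,7)
  \<comment> \<open>This is the right derivative of \<open>x\<close> on \<open>{a..b}\<close> in a
    form whose continuity is evident.\<close>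
  let ?D = "\<lambda>t. of_real \<beta> * (x t + R x t)"

  \<comment> \<open>The adjointness of the two memory terms. Exchanging the integrals puts \<kappa>
    on the conjugate of \<open>x\<close>; as \<kappa> is real-valued, the result is the conjugate of
    \<open>R x\<close>.\<close>
  have adj: "integral {a..b} (\<lambda>t. cnj (x t) * L y t) = integral {a..b} (\<lambda>t. y t * cnj (R x t))"
  proof -
    obtain C where C: "\<And>t. norm (zero_ext a b x t) \<le> C"
      using zero_ext_bounded[OF xc] by blast
    have "integral {a..b} (\<lambda>t. cnj (x t) * L y t)
        = (LBINT t. zero_ext a b (\<lambda>t. cnj (x t) * L y t) t)"
      by (intro integral_zero_ext [symmetric] cont)
    also have "\<dots> = (LBINT t. cnj (zero_ext a b x t) * L y t)"
      by (simp add: zero_ext_def)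
    also have "\<dots> = (LBINT s. zero_ext a b y s * (LBINT t. cnj (zero_ext a b x t) * \<kappa> (t - s)))"
      unfolding L_def
    proof (rule convolution_adjoint[OF zero_ext_integrable[OF yc] \<kappa>(1)])
      show "(\<lambda>t. cnj (zero_ext a b x t)) \<in> borel_measurable borel"
        using zero_ext_measurable[OF xc]
        by (rule measurable_compose) (intro borel_measurable_continuous_onI continuous_intros)
      show "norm (cnj (zero_ext a b x t)) \<le> C" for t
        using C by simp
    qed
    also have "\<dots> = (LBINT s. zero_ext a b y s * cnj (R x s))"
      unfolding R_def Bochner_Integration.integral_cnj [symmetric]
      by (simp add: \<kappa>_def del: Bochner_Integration.integral_cnj)
    also have "\<dots> = (LBINT s. zero_ext a b (\<lambda>s. y s * cnj (R x s)) s)"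
      by (simp add: zero_ext_def)
    also have "\<dots> = integral {a..b} (\<lambda>t. y t * cnj (R x t))"
      by (intro integral_zero_ext cont)
    finally show ?thesis .
  qed
  define P Q W where "P = integral {a..b} (\<lambda>t. p t * (cmod (?D t))\<^sup>2)"
    and "Q = integral {a..b} (\<lambda>t. q t * (cmod (x t))\<^sup>2)"
    and "W = integral {a..b} (\<lambda>t. r t * (cmod (x t))\<^sup>2)"
  have of_real_integral: "integral {a..b} (\<lambda>t. complex_of_real (g t)) = of_real (integral {a..b} g)"
    if "continuous_on {a..b} g" for g
    by (intro integral_unique has_integral_of_real integrable_integral integrable_continuous_real that)
  have of_real_W: "integral {a..b} (\<lambda>t. complex_of_real (r t * (cmod (x t))\<^sup>2)) = of_real W"
    and of_real_Q: "integral {a..b} (\<lambda>t. complex_of_real (q t * (cmod (x t))\<^sup>2)) = of_real Q"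
    unfolding W_def Q_def by (intro of_real_integral cont)+
  note integral_add = Henstock_Kurzweil_Integration.integral_add
    and integral_diff = Henstock_Kurzweil_Integration.integral_diff

  have "integral {a..b} (\<lambda>t. cnj (x t) * ABR_left B \<alpha> a b y t)
      = integral {a..b} (\<lambda>t. of_real \<beta> * (cnj (x t) * y t + cnj (x t) * L y t))"
    by (intro Henstock_Kurzweil_Integration.integral_cong)
      (simp add: ABR_left[OF yc] algebra_simps)
  also have "\<dots> = of_real \<beta> * (integral {a..b} (\<lambda>t. cnj (x t) * y t)
      + integral {a..b} (\<lambda>t. cnj (x t) * L y t))"
    by (subst integral_add [symmetric]) (auto intro!: integrable_continuous_real cont)
  also have "\<dots> = of_real \<beta> * integral {a..b} (\<lambda>t. cnj (x t) * y t + y t * cnj (R x t))"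
    unfolding adj by (subst integral_add) (auto intro!: integrable_continuous_real cont)
  also have "\<dots> = integral {a..b} (\<lambda>t. of_real \<beta> * (cnj (x t) * y t + y t * cnj (R x t)))"
    by simp
  also have "\<dots> = integral {a..b} (\<lambda>t. complex_of_real (p t * (cmod (?D t))\<^sup>2))"
  proof (intro Henstock_Kurzweil_Integration.integral_cong)
    fix t assume t: "t \<in> {a..b}"
    \<comment> \<open>Since \<beta> is real, the bracket collapses to the conjugate of
      \<open>?D t\<close>; the factor \<open>?D t\<close> inside \<open>y t\<close> then completes
      the squared modulus.\<close>
    have "of_real \<beta> * (cnj (x t) * y t + y t * cnj (R x t)) = y t * cnj (?D t)"
      by (simp add: algebra_simps)
    also have "\<dots> = of_real (p t) * ?D t * cnj (?D t)"
      by (simp add: y_def ABR_right[OF xc t])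
    also have "\<dots> = complex_of_real (p t * (cmod (?D t))\<^sup>2)"
      by (simp only: mult.assoc complex_norm_square [symmetric] of_real_mult of_real_power)
    finally show "of_real \<beta> * (cnj (x t) * y t + y t * cnj (R x t))
        = complex_of_real (p t * (cmod (?D t))\<^sup>2)" .
  qed
  also have "\<dots> = of_real P"
    unfolding P_def by (intro of_real_integral cont)
  finally have 1: "integral {a..b} (\<lambda>t. cnj (x t) * ABR_left B \<alpha> a b y t) = of_real P" .

  have "integral {a..b} (\<lambda>t. cnj (x t) * ABR_left B \<alpha> a b y t) =
      integral {a..b} (\<lambda>t. \<mu> * complex_of_real (r t * (cmod (x t))\<^sup>2) - of_real (q t * (cmod (x t))\<^sup>2))"
  \<comment> \<open>The equation is given on the open interval only; the two endpoints are
    negligible.\<close>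
  proof (rule integral_spike[of "{a, b}"])
    fix t assume "t \<in> {a..b} - {a, b}"
    hence *: "ABR_left B \<alpha> a b y t = \<mu> * of_real (r t) * x t - of_real (q t) * x t"
      using eq[of t] by (simp add: algebra_simps)
    show "\<mu> * complex_of_real (r t * (cmod (x t))\<^sup>2) - of_real (q t * (cmod (x t))\<^sup>2)
        = cnj (x t) * ABR_left B \<alpha> a b y t"
      unfolding * by (simp add: complex_norm_square algebra_simps del: of_real_power)
  qed simp
  also have "\<dots> = \<mu> * of_real W - of_real Q"
    unfolding of_real_W [symmetric] of_real_Q [symmetric]
    by (subst integral_diff)
      (auto intro!: integrable_continuous_real cont simp del: of_real_mult of_real_power)
  finally have "\<mu> * of_real W = of_real (P + Q)"
    using 1 by (simp add: algebra_simps)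
  \<comment> \<open>A continuous nonnegative integrand with zero integral vanishes identically,
    which positivity of \<open>r\<close> forbids at a point where \<open>x\<close> is nonzero.
    Dividing by \<open>W\<close> then exhibits \<mu> as a quotient of real numbers.\<close>
  moreover have "W \<noteq> 0"
  proof
    assume "W = 0"
    hence "\<forall>t\<in>{a..b}. r t * (cmod (x t))\<^sup>2 = 0"
      unfolding W_def using assms(1,9)
      by (subst (asm) integral_eq_0_iff) (auto intro!: cont simp: less_imp_le)
    thus False using nz assms(9) by force
  qed
  ultimately have "\<mu> = of_real ((P + Q) / W)"
    by (simp add: field_simps)
  thus ?thesis by (metis Reals_of_real)
qed

end
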